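(* Let $n\ge5$ be an odd integer and let $a$ be real with $1\le a\le4$. Then for each baby Mandelbrot set in the $c$-parameter plane of $R_{n,a,c}$ associated with the critical orbit of $v_+$, there exists a matching baby Mandelbrot set associated with the critical orbit of $v_-$, namely its reflection over the imaginary axis of the $c$-plane.
   Context: For $n\in\mathbb{N}$, $a\in\mathbb{C}\setminus\{0\}$, $c\in\mathbb{C}$, let $R_{n,a,c}(z)=z^n+\dfrac{a}{z^n}+c$, with critical values $v_\pm=c\pm2\sqrt a$ (positive square root for $a>0$). The Mandelbrot set $\mathcal{M}$ is the set of $c\in\mathbb{C}$ such that the orbit of $0$ under $z\mapsto z^2+c$ is bounded. For fixed $n,a$, a baby Mandelbrot set associated with the critical orbit of $v_+$ (respectively $v_-$) is a subset of the $c$-plane that is homeomorphic to $\mathcal{M}$ and consists of parameters $c$ for which the orbit of $v_+$ (respectively $v_-$) under $R_{n,a,c}$ is bounded. Reflection over the imaginary axis is $c\mapsto-\overline{c}$. *)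

theory Defs
  imports "HOL-Analysis.Analysis"
begin

text \<open>
  The map \<open>z \<mapsto> z^n + a/z^n + c\<close> (for \<open>n \<ge> 1\<close>, \<open>a \<noteq> 0\<close>) on the Riemann sphere, with \<^term>\<open>None\<close>
  as the point at infinity. The pole at \<open>0\<close> has to be treated separately because division by
  zero yields \<open>0\<close> in HOL.
\<close>

definition R :: "nat \<Rightarrow> complex \<Rightarrow> complex \<Rightarrow> complex option \<Rightarrow> complex option" where
  "R n a c p = (case p of
      None \<Rightarrow> None
    | Some z \<Rightarrow> if z = 0 then None else Some (z ^ n + a / z ^ n + c))"

text \<open>A bounded orbit stays in a bounded subset of the plane; in particular it never hits infinity.\<close>

definition bounded_orbit :: "nat \<Rightarrow> complex \<Rightarrow> complex \<Rightarrow> complex \<Rightarrow> bool" where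
  "bounded_orbit n a c v \<longleftrightarrow>
     (\<exists>K. bounded K \<and> (\<forall>k. (R n a c ^^ k) (Some v) \<in> Some ` K))"

text \<open>For real \<open>a > 0\<close>, \<^term>\<open>csqrt\<close> is the positive square root.\<close>

definition v_plus :: "complex \<Rightarrow> complex \<Rightarrow> complex" where
  "v_plus a c = c + 2 * csqrt a"

definition v_minus :: "complex \<Rightarrow> complex \<Rightarrow> complex" where
  "v_minus a c = c - 2 * csqrt a"

definition Mandelbrot :: "complex set" where
  "Mandelbrot = {c. bounded (range (\<lambda>k. ((\<lambda>z. z ^ 2 + c) ^^ k) 0))}"

text \<open>
  The argument \<open>v\<close> selects the critical value as a function of \<open>a\<close> and \<open>c\<close>
  (\<^term>\<open>v_plus\<close> or \<^term>\<open>v_minus\<close>).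
\<close>

definition baby_Mandelbrot ::
    "nat \<Rightarrow> complex \<Rightarrow> (complex \<Rightarrow> complex \<Rightarrow> complex) \<Rightarrow> complex set \<Rightarrow> bool" where
  "baby_Mandelbrot n a v B \<longleftrightarrow>
     B homeomorphic Mandelbrot \<and> (\<forall>c\<in>B. bounded_orbit n a c (v a c))"

definition reflect_imaginary_axis :: "complex \<Rightarrow> complex" where
  "reflect_imaginary_axis c = - cnj c"

end

theory Submission imports Defs begin

text \<open>
  For odd \<open>n\<close> and real \<open>a\<close> the reflection \<open>\<rho>(z) = - cnj z\<close> commutes with \<open>z \<mapsto> z^n + a/z^n\<close>, so it
  conjugates the map with parameter \<open>c\<close> to the map with parameter \<open>\<rho>(c)\<close>. Since \<open>\<surd>a\<close> is real for
  \<open>a > 0\<close>, it carries \<open>v\<^sub>+\<close> at \<open>c\<close> to \<open>v\<^sub>-\<close> at \<open>\<rho>(c)\<close>, hence the orbit of the former to the orbit of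
  the latter. Being an isometry, \<open>\<rho>\<close> preserves boundedness and homeomorphism type.
\<close>

text \<open>Odd powers commute with negation and conjugation, and the real \<open>a\<close> is fixed
  by \<open>cnj\<close>. The reflection fixes 0, so the pole still goes to
  \<open>None\<close>.\<close>

lemma R_reflect:
  assumes "odd n"
  shows "R n (complex_of_real a) (reflect_imaginary_axis c) (map_option reflect_imaginary_axis p)
    = map_option reflect_imaginary_axis (R n (complex_of_real a) c p)"
  using assms by (auto simp: R_def reflect_imaginary_axis_def split: option.splits)

lemma R_funpow_reflect:
  assumes "odd n"
  shows "(R n (complex_of_real a) (reflect_imaginary_axis c) ^^ k) (map_option reflect_imaginary_axis p)
    = map_option reflect_imaginary_axis ((R n (complex_of_real a) c ^^ k) p)"
  by (induction k) (simp_all add: R_reflect[OF assms])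

lemma bounded_reflect:
  assumes "bounded K"
  shows "bounded (reflect_imaginary_axis ` K)"
  using assms by (auto simp: bounded_iff reflect_imaginary_axis_def)

lemma bounded_orbit_reflect:
  assumes "odd n" "bounded_orbit n (complex_of_real a) c v"
  shows "bounded_orbit n (complex_of_real a) (reflect_imaginary_axis c) (reflect_imaginary_axis v)"
proof -
  obtain K where K: "bounded K" "\<And>k. (R n (complex_of_real a) c ^^ k) (Some v) \<in> Some ` K"
    using assms(2) by (auto simp: bounded_orbit_def)
  have "(R n (complex_of_real a) (reflect_imaginary_axis c) ^^ k) (Some (reflect_imaginary_axis v))
      \<in> Some ` reflect_imaginary_axis ` K" for k
    using R_funpow_reflect[OF assms(1), where a = a and c = c and k = k and p = "Some v"] K(2)[of k] by auto
  then show ?thesis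
    unfolding bounded_orbit_def using bounded_reflect[OF K(1)] by blast
qed

lemma reflect_v_plus:
  assumes "0 \<le> a"
  shows "reflect_imaginary_axis (v_plus (complex_of_real a) c)
    = v_minus (complex_of_real a) (reflect_imaginary_axis c)"
  using assms
  \<comment> \<open>Flipped, \<open>of_real_sqrt\<close> turns \<open>csqrt\<close> into a real
    root, which \<open>cnj\<close> fixes.\<close>
  by (simp add: reflect_imaginary_axis_def v_plus_def v_minus_def flip: of_real_sqrt)

lemma homeomorphic_reflect: "reflect_imaginary_axis ` B homeomorphic B"
  unfolding homeomorphic_minimal
  \<comment> \<open>The reflection is an involution, so it serves as both the map and its
    inverse.\<close>
  by (intro exI[of _ reflect_imaginary_axis])
    (auto simp: reflect_imaginary_axis_def intro!: continuous_intros)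

theorem theorem4p11:
  fixes n :: nat and a :: real
  assumes "odd n" and "n \<ge> 5" and "1 \<le> a" and "a \<le> 4"
  shows "\<forall>B. baby_Mandelbrot n (complex_of_real a) v_plus B \<longrightarrow>
    (\<exists>B'. B' = reflect_imaginary_axis ` B \<and> baby_Mandelbrot n (complex_of_real a) v_minus B')"
proof (intro allI impI exI conjI)
  fix B
  assume B: "baby_Mandelbrot n (complex_of_real a) v_plus B"
  have "reflect_imaginary_axis ` B homeomorphic Mandelbrot"
    using B homeomorphic_trans[OF homeomorphic_reflect] by (auto simp: baby_Mandelbrot_def)
  moreover have "bounded_orbit n (complex_of_real a) (reflect_imaginary_axis c)
      (v_minus (complex_of_real a) (reflect_imaginary_axis c))" if "c \<in> B" for c
    using B that bounded_orbit_reflect[OF assms(1)] reflect_v_plus[of a c] assms(3)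
    by (fastforce simp: baby_Mandelbrot_def)
  ultimately show "baby_Mandelbrot n (complex_of_real a) v_minus (reflect_imaginary_axis ` B)"
    by (auto simp: baby_Mandelbrot_def)
qed simp

end
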